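(* Let $Q^0,Q^1,\dots,Q^m\in\mathbb{S}^n$ and $b_1,\dots,b_m\in\mathbb{R}$, and consider the homogeneous QCQP $$\min_{x\in\mathbb{R}^n}\ x^{\mathrm T}Q^0x\quad\text{subject to}\quad x^{\mathrm T}Q^px\le b_p,\quad p=1,\dots,m,$$ and its SDP relaxation $$\min_{X\in\mathbb{S}^n}\ Q^0\bullet X\quad\text{subject to}\quad Q^p\bullet X\le b_p,\ p=1,\dots,m,\quad X\succeq O.$$ Assume that: (a) the QCQP has a feasible point; (b) there exists $\bar y\in\mathbb{R}^m$, $\bar y\ge 0$, with $\sum_{p=1}^m\bar y_pQ^p\succ O$; (c) the SDP relaxation has an interior feasible point. Suppose the QCQP is forest-structured. For $y\in\mathbb{R}^m$ let $S(y):=Q^0+\sum_{p=1}^m y_pQ^p$. If for every $(k,\ell)\in\mathrm{od}(n)$ the system $$y\ge 0,\qquad S(y)\succeq O,\qquad [S(y)]_{k\ell}=0$$ has no solution $y\in\mathbb{R}^m$, then the SDP relaxation is exact.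
   Context: $\mathbb{S}^n$ is the space of real symmetric $n\times n$ matrices; $M\succeq O$ (resp. $M\succ O$) means $M$ is positive semidefinite (resp. positive definite); $M\bullet N=\operatorname{tr}(M^{\mathrm T}N)$; $[M]_{ij}$ is the $(i,j)$ entry of $M$; $y\ge 0$ is meant entrywise. Aggregate sparsity graph: the graph $G(\mathcal V,\mathcal E)$ with $\mathcal V=\{1,\dots,n\}$ and $\mathcal E=\{(i,j)\in\mathcal V\times\mathcal V : [Q^p]_{ij}\ne 0\text{ for some }p\in\{0,1,\dots,m\}\}$. The QCQP is called forest-structured if this graph is a forest, i.e. the simple undirected graph on $\mathcal V$ whose edges are the pairs $(i,j)\in\mathcal E$ with $i<j$ has no cycles (it need not be connected; diagonal entries are ignored). Set $\mathrm{od}(n):=\{(i,j)\in\mathcal E : i<j\}$. An interior feasible point of the SDP relaxation is a matrix $X\succ O$ satisfying its linear constraints. The SDP relaxation is called exact if it has an optimal solution of the form $X^*=x^*(x^* )^{\mathrm T}$ with $x^*\in\mathbb{R}^n$ (such an $x^*$ is then optimal for the QCQP). *)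

theory Defs
  imports "HOL-Analysis.Analysis"
begin

section \<open>Symmetric, positive semidefinite and positive definite matrices\<close>

definition symmetric_mat :: "real ^ 'n ^ 'n \<Rightarrow> bool" where
  "symmetric_mat M \<longleftrightarrow> transpose M = M"

definition pos_semidef :: "real ^ 'n ^ 'n \<Rightarrow> bool" where
  "pos_semidef M \<longleftrightarrow> symmetric_mat M \<and> (\<forall>x. 0 \<le> x \<bullet> (M *v x))"

definition pos_def :: "real ^ 'n ^ 'n \<Rightarrow> bool" where
  "pos_def M \<longleftrightarrow> symmetric_mat M \<and> (\<forall>x. x \<noteq> 0 \<longrightarrow> 0 < x \<bullet> (M *v x))"

definition frob :: "real ^ 'n ^ 'n \<Rightarrow> real ^ 'n ^ 'n \<Rightarrow> real" where
  "frob M N = trace (transpose M ** N)"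

definition rank_one :: "real ^ 'n \<Rightarrow> real ^ 'n ^ 'n" where
  "rank_one x = (columnvector x :: real ^ 1 ^ 'n) ** (rowvector x :: real ^ 'n ^ 1)"


section \<open>The QCQP and its SDP relaxation\<close>

text \<open>
  The data are \<open>Q 0, \<dots>, Q m\<close> and \<open>b 1, \<dots>, b m\<close>; a vector \<open>y\<close> of multipliers in
  \<open>\<real>\<^sup>m\<close> is a function of which only the values at \<open>1, \<dots>, m\<close> are used. Values of
  \<open>Q\<close>, \<open>b\<close> and \<open>y\<close> at other indices are irrelevant throughout.
  The set of row indices \<open>{1, \<dots>, n}\<close> is rendered by a finite linearly ordered type.
\<close>

definition qcqp_feasible ::
    "nat \<Rightarrow> (nat \<Rightarrow> real ^ 'n ^ 'n) \<Rightarrow> (nat \<Rightarrow> real) \<Rightarrow> real ^ 'n \<Rightarrow> bool" where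
  "qcqp_feasible m Q b x \<longleftrightarrow> (\<forall>p\<in>{1..m}. x \<bullet> (Q p *v x) \<le> b p)"

definition qcqp_optimal ::
    "nat \<Rightarrow> (nat \<Rightarrow> real ^ 'n ^ 'n) \<Rightarrow> (nat \<Rightarrow> real) \<Rightarrow> real ^ 'n \<Rightarrow> bool" where
  "qcqp_optimal m Q b = is_arg_min (\<lambda>x. x \<bullet> (Q 0 *v x)) (qcqp_feasible m Q b)"

definition sdp_linear_constraints ::
    "nat \<Rightarrow> (nat \<Rightarrow> real ^ 'n ^ 'n) \<Rightarrow> (nat \<Rightarrow> real) \<Rightarrow> real ^ 'n ^ 'n \<Rightarrow> bool" where
  "sdp_linear_constraints m Q b X \<longleftrightarrow> (\<forall>p\<in>{1..m}. frob (Q p) X \<le> b p)"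

definition sdp_feasible ::
    "nat \<Rightarrow> (nat \<Rightarrow> real ^ 'n ^ 'n) \<Rightarrow> (nat \<Rightarrow> real) \<Rightarrow> real ^ 'n ^ 'n \<Rightarrow> bool" where
  "sdp_feasible m Q b X \<longleftrightarrow> sdp_linear_constraints m Q b X \<and> pos_semidef X"

definition sdp_interior_feasible ::
    "nat \<Rightarrow> (nat \<Rightarrow> real ^ 'n ^ 'n) \<Rightarrow> (nat \<Rightarrow> real) \<Rightarrow> real ^ 'n ^ 'n \<Rightarrow> bool" where
  "sdp_interior_feasible m Q b X \<longleftrightarrow> sdp_linear_constraints m Q b X \<and> pos_def X"

definition sdp_optimal ::
    "nat \<Rightarrow> (nat \<Rightarrow> real ^ 'n ^ 'n) \<Rightarrow> (nat \<Rightarrow> real) \<Rightarrow> real ^ 'n ^ 'n \<Rightarrow> bool" where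
  "sdp_optimal m Q b = is_arg_min (frob (Q 0)) (sdp_feasible m Q b)"

definition sdp_exact ::
    "nat \<Rightarrow> (nat \<Rightarrow> real ^ 'n ^ 'n) \<Rightarrow> (nat \<Rightarrow> real) \<Rightarrow> bool" where
  "sdp_exact m Q b \<longleftrightarrow> (\<exists>x. sdp_optimal m Q b (rank_one x))"

definition dual_slack ::
    "nat \<Rightarrow> (nat \<Rightarrow> real ^ 'n ^ 'n) \<Rightarrow> (nat \<Rightarrow> real) \<Rightarrow> real ^ 'n ^ 'n" where
  "dual_slack m Q y = Q 0 + (\<Sum>p=1..m. y p *\<^sub>R Q p)"


section \<open>The aggregate sparsity graph\<close>

definition sparsity_edges ::
    "nat \<Rightarrow> (nat \<Rightarrow> real ^ 'n ^ 'n) \<Rightarrow> ('n \<times> 'n) set" where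
  "sparsity_edges m Q = {(i, j). \<exists>p\<in>{0..m}. Q p $ i $ j \<noteq> 0}"

definition od ::
    "nat \<Rightarrow> (nat \<Rightarrow> real ^ 'n::{finite,linorder} ^ 'n::{finite,linorder}) \<Rightarrow> ('n \<times> 'n) set" where
  "od m Q = {(i, j) \<in> sparsity_edges m Q. i < j}"

text \<open>
  A simple undirected graph is given by its set of two-element edges. A cycle is the list
  of its pairwise distinct vertices in cyclic order, so it has length at least 3. (The
  forests of the AFP entry Graph Theory are digraphs without directed cycle, which is a
  different notion: a pair of opposite arcs is already a cycle there.)
\<close>

definition is_cycle :: "'a set set \<Rightarrow> 'a list \<Rightarrow> bool" where
  "is_cycle E vs \<longleftrightarrow> 3 \<le> length vs \<and> distinct vs \<and>
     (\<forall>i<length vs. {vs ! i, vs ! (Suc i mod length vs)} \<in> E)"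

definition is_forest :: "'a set set \<Rightarrow> bool" where
  "is_forest E \<longleftrightarrow> (\<nexists>vs. is_cycle E vs)"

definition forest_structured ::
    "nat \<Rightarrow> (nat \<Rightarrow> real ^ 'n::{finite,linorder} ^ 'n::{finite,linorder}) \<Rightarrow> bool" where
  "forest_structured m Q \<longleftrightarrow> is_forest {{i, j} |i j. (i, j) \<in> od m Q}"


section \<open>An exact relaxation solves the QCQP\<close>

lemma frob_rank_one: "frob M (rank_one x) = x \<bullet> (M *v x)"
proof -
  have "frob M (rank_one x) = (\<Sum>i\<in>UNIV. \<Sum>k\<in>UNIV. M $ k $ i * (x $ k * x $ i))"
    by (simp add: frob_def rank_one_def trace_def matrix_matrix_mult_def transpose_def
        columnvector_def rowvector_def)
  also have "\<dots> = (\<Sum>k\<in>UNIV. \<Sum>i\<in>UNIV. M $ k $ i * (x $ k * x $ i))"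
    by (rule sum.swap)
  also have "\<dots> = x \<bullet> (M *v x)"
    by (simp add: inner_vec_def matrix_vector_mult_def sum_distrib_left mult_ac)
  finally show ?thesis .
qed

lemma pos_semidef_rank_one: "pos_semidef (rank_one x)"
proof -
  have "rank_one x *v v = (x \<bullet> v) *\<^sub>R x" for v
    by (simp add: vec_eq_iff rank_one_def matrix_vector_mult_def matrix_matrix_mult_def
        columnvector_def rowvector_def inner_vec_def sum_distrib_left sum_distrib_right mult_ac)
  then have "0 \<le> v \<bullet> (rank_one x *v v)" for v
    by (simp add: inner_commute)
  moreover have "symmetric_mat (rank_one x)"
    by (simp add: symmetric_mat_def vec_eq_iff rank_one_def matrix_matrix_mult_def
        columnvector_def rowvector_def transpose_def mult.commute)
  ultimately show ?thesis
    by (simp add: pos_semidef_def)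
qed

lemma sdp_feasible_rank_one: "sdp_feasible m Q b (rank_one x) \<longleftrightarrow> qcqp_feasible m Q b x"
  by (simp add: sdp_feasible_def sdp_linear_constraints_def qcqp_feasible_def
      frob_rank_one pos_semidef_rank_one)

lemma sdp_optimal_rank_one_imp_qcqp_optimal:
  assumes "sdp_optimal m Q b (rank_one x)"
  shows "qcqp_optimal m Q b x"
  using assms
  by (metis (no_types, lifting) frob_rank_one is_arg_min_def qcqp_optimal_def
      sdp_feasible_rank_one sdp_optimal_def)

end

theory Submission
  imports Defs
begin

text \<open>
  Assumption (b) makes the feasible set compact, so an optimal \<open>X\<close> exists; the interior feasible
  point yields an optimal dual \<open>y\<close>, and complementary slackness says \<open>S X = 0\<close> for
  \<open>S = dual_slack m Q y\<close>. By hypothesis the off-diagonal support of \<open>S\<close> is the entire forest. On a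
  component of a forest a kernel vector of a positive semidefinite \<open>S\<close> that vanishes at one vertex
  vanishes identically, so \<open>X\<close> has rank at most one on each component. Gluing the factors gives \<open>x\<close>
  such that \<open>x x\<^sup>T\<close> agrees with \<open>X\<close> on the support of every \<open>Q p\<close>, hence is optimal too.
\<close>

section \<open>Positive semidefinite matrices\<close>

lemma frob_eq_inner: "frob M N = M \<bullet> N"
proof -
  have "frob M N = (\<Sum>i\<in>UNIV. \<Sum>k\<in>UNIV. M $ k $ i * N $ k $ i)"
    by (simp add: frob_def trace_def matrix_matrix_mult_def transpose_def)
  also have "\<dots> = M \<bullet> N"
    unfolding inner_vec_def by (subst sum.swap) simp
  finally show ?thesis .
qed

lemma rank_one_nth: "rank_one x $ i $ j = x $ i * x $ j"
  by (simp add: rank_one_def matrix_matrix_mult_def columnvector_def rowvector_def)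

lemma inner_rank_one: "M \<bullet> rank_one x = x \<bullet> (M *v x)"
  using frob_rank_one[of M x] by (simp add: frob_eq_inner)

lemma rank_one_mult_vec: "rank_one x *v y = (x \<bullet> y) *\<^sub>R x"
  by (simp add: vec_eq_iff matrix_vector_mult_def rank_one_nth inner_vec_def
      sum_distrib_left sum_distrib_right mult_ac)

lemma symmetric_mat_nth: "symmetric_mat M \<Longrightarrow> M $ i $ j = M $ j $ i"
  by (simp add: symmetric_mat_def transpose_def vec_eq_iff)

lemma symmetric_matI: "(\<And>i j. M $ i $ j = M $ j $ i) \<Longrightarrow> symmetric_mat M"
  by (simp add: symmetric_mat_def transpose_def vec_eq_iff)

lemma symmetric_mat_inner_commute:
  assumes "symmetric_mat M"
  shows "x \<bullet> (M *v y) = y \<bullet> (M *v x)"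
  using assms by (metis dot_lmul_matrix inner_commute symmetric_mat_def transpose_matrix_vector)

lemma symmetric_mat_transpose_inner:
  assumes "symmetric_mat M"
  shows "M \<bullet> transpose X = M \<bullet> X"
proof -
  have "M \<bullet> transpose X = (\<Sum>i\<in>UNIV. \<Sum>k\<in>UNIV. M $ k $ i * X $ k $ i)"
    using symmetric_mat_nth[OF assms] by (simp add: inner_vec_def transpose_def)
  also have "\<dots> = M \<bullet> X"
    unfolding inner_vec_def by (subst sum.swap) simp
  finally show ?thesis .
qed

lemma pos_def_imp_pos_semidef: "pos_def M \<Longrightarrow> pos_semidef M"
  unfolding pos_def_def pos_semidef_def
  by (metis inner_zero_left less_eq_real_def)

text \<open>Moving from \<open>x\<close> in the direction \<open>- (X *v x)\<close> would make the
  quadratic form negative to first order unless \<open>X *v x\<close> is \<open>0\<close>.\<close>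

lemma pos_semidef_mult_eq_0:
  assumes "pos_semidef X" and "x \<bullet> (X *v x) = 0"
  shows "X *v x = 0"
proof -
  define y where "y = X *v x"
  define c where "c = y \<bullet> (X *v y)"
  have sym: "symmetric_mat X" and psd: "0 \<le> z \<bullet> (X *v z)" for z
    using assms by (auto simp: pos_semidef_def)
  have *: "0 \<le> - 2 * t * (y \<bullet> y) + t\<^sup>2 * c" for t
  proof -
    have "(x - t *\<^sub>R y) \<bullet> (X *v (x - t *\<^sub>R y)) = - 2 * t * (y \<bullet> y) + t\<^sup>2 * c"
      using assms(2) symmetric_mat_inner_commute[OF sym, of x y]
      by (simp add: c_def matrix_vector_mult_diff_distrib matrix_vector_mult_scaleR inner_diff_left
          inner_diff_right y_def[symmetric] inner_commute algebra_simps power2_eq_square)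
    then show ?thesis
      using psd by metis
  qed
  have "y \<bullet> y \<le> 0"
  proof (cases "c = 0")
    case True
    then show ?thesis
      using *[of 1] by simp
  next
    case False
    then have "c > 0"
      using psd[of y] by (simp add: c_def)
    moreover have "- 2 * (y \<bullet> y / c) * (y \<bullet> y) + (y \<bullet> y / c)\<^sup>2 * c = - ((y \<bullet> y)\<^sup>2 / c)"
      using \<open>c > 0\<close> by (simp add: field_simps power2_eq_square)
    ultimately show ?thesis
      using *[of "y \<bullet> y / c"] by (simp add: divide_le_0_iff)
  qed
  then have "y \<bullet> y = 0"
    by (intro order.antisym) simp_all
  then show ?thesis
    by (simp add: y_def)
qed

lemma axis_inner_mult: "axis i 1 \<bullet> (M *v x) = (M *v x) $ i" for M :: "real^'n^'m"
  by (simp add: inner_axis')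

lemma mult_axis_nth: "(M *v axis j 1) $ i = M $ i $ j" for M :: "real^'n^'m"
  by (simp add: matrix_vector_mul_component inner_axis)

lemma pos_semidef_diag_nonneg:
  assumes "pos_semidef X"
  shows "0 \<le> X $ i $ i"
proof -
  have "0 \<le> axis i 1 \<bullet> (X *v axis i 1)"
    using assms by (simp add: pos_semidef_def)
  then show ?thesis
    by (simp only: axis_inner_mult mult_axis_nth)
qed

text \<open>The form of \<open>X\<close> vanishes at the \<open>i\<close>-th unit vector, which
  therefore lies in the kernel.\<close>

lemma pos_semidef_diag_eq_0:
  assumes "pos_semidef X" and "X $ i $ i = 0"
  shows "X $ i $ j = 0"
proof -
  have "X *v axis i 1 = 0"
    using assms by (intro pos_semidef_mult_eq_0) (simp_all only: axis_inner_mult mult_axis_nth)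
  then have "X $ j $ i = 0"
    by (metis mult_axis_nth zero_index)
  then show ?thesis
    using assms by (simp add: pos_semidef_def symmetric_mat_nth)
qed

text \<open>Cholesky elimination: subtracting a rank-one matrix clears a nonzero diagonal entry.\<close>

lemma pos_semidef_eq_sum_rank_one:
  assumes "pos_semidef X"
  shows "\<exists>vs. X = (\<Sum>v\<leftarrow>vs. rank_one v)"
  using assms
proof (induction "card {i. X $ i $ i \<noteq> 0}" arbitrary: X rule: less_induct)
  case less
  have sym: "symmetric_mat X" and psd: "0 \<le> z \<bullet> (X *v z)" for z
    using less.prems by (auto simp: pos_semidef_def)
  show ?case
  proof (cases "\<exists>i. X $ i $ i \<noteq> 0")
    case False
    then have "X = 0"
      using pos_semidef_diag_eq_0[OF less.prems] by (simp add: vec_eq_iff)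
    then show ?thesis
      by (intro exI[of _ "[]"]) simp
  next
    case True
    then obtain i where "X $ i $ i \<noteq> 0"
      by blast
    define d where "d = X $ i $ i"
    have "d > 0"
      using \<open>X $ i $ i \<noteq> 0\<close> pos_semidef_diag_nonneg[OF less.prems, of i] by (simp add: d_def)
    define e :: "real^'a" where "e = axis i 1"
    define w where "w = (1 / sqrt d) *\<^sub>R (X *v e)"
    define Y where "Y = X - rank_one w"
    have w: "w $ j = X $ j $ i / sqrt d" for j
      by (simp add: w_def e_def mult_axis_nth)
    have Y: "Y $ j $ k = X $ j $ k - X $ j $ i * X $ k $ i / d" for j k
      using \<open>d > 0\<close> by (simp add: Y_def rank_one_nth w)
    have "pos_semidef Y"
      unfolding pos_semidef_def
    proof (intro conjI allI)
      show "symmetric_mat Y"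
        by (intro symmetric_matI) (simp add: Y symmetric_mat_nth[OF sym] mult.commute)
    next
      fix x
      define s where "s = x \<bullet> (X *v e)"
      \<comment> \<open>On the line through \<open>x\<close> in direction \<open>e\<close> the form
        of \<open>X\<close> is smallest at \<open>z\<close>, and this minimum is the form of
        \<open>Y\<close> at \<open>x\<close>.\<close>
      define z where "z = x - (s / d) *\<^sub>R e"
      have ee: "e \<bullet> (X *v e) = d"
        by (simp only: e_def axis_inner_mult mult_axis_nth d_def)
      have ex: "e \<bullet> (X *v x) = s"
        by (simp add: s_def symmetric_mat_inner_commute[OF sym, of e x])
      have "z \<bullet> (X *v z) = x \<bullet> (X *v x) - s\<^sup>2 / d"
        using \<open>d > 0\<close>
        by (simp add: z_def matrix_vector_mult_diff_distrib matrix_vector_mult_scaleR inner_diff_left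
            inner_diff_right ee ex s_def[symmetric] field_simps power2_eq_square)
      also have "\<dots> = x \<bullet> (Y *v x)"
        using \<open>d > 0\<close>
        by (simp add: Y_def w_def matrix_vector_mult_diff_rdistrib rank_one_mult_vec inner_diff_right
            inner_commute[of _ x] s_def[symmetric] power2_eq_square)
      finally show "0 \<le> x \<bullet> (Y *v x)"
        using psd[of z] by simp
    qed
    \<comment> \<open>A zero diagonal entry of \<open>X\<close> makes its whole row zero, so it
      stays zero in \<open>Y\<close>; the entry at \<open>i\<close> is newly cleared.\<close>
    moreover have "card {j. Y $ j $ j \<noteq> 0} < card {j. X $ j $ j \<noteq> 0}"
    proof (intro psubset_card_mono psubsetI subsetI)
      show "j \<in> {j. X $ j $ j \<noteq> 0}" if "j \<in> {j. Y $ j $ j \<noteq> 0}" for j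
        using that pos_semidef_diag_eq_0[OF less.prems, of j i] by (auto simp: Y)
      have "Y $ i $ i = 0"
        using \<open>d > 0\<close> by (simp add: Y d_def)
      then show "{j. Y $ j $ j \<noteq> 0} \<noteq> {j. X $ j $ j \<noteq> 0}"
        using \<open>X $ i $ i \<noteq> 0\<close> by blast
    qed auto
    ultimately obtain vs where "Y = (\<Sum>v\<leftarrow>vs. rank_one v)"
      using less.hyps by blast
    then have "X = (\<Sum>v\<leftarrow>w # vs. rank_one v)"
      by (simp add: Y_def algebra_simps)
    then show ?thesis
      by blast
  qed
qed

section \<open>Trace pairings of positive semidefinite matrices\<close>

lemma inner_sum_rank_one:
  "M \<bullet> (\<Sum>v\<leftarrow>vs. rank_one v) = (\<Sum>v\<leftarrow>vs. v \<bullet> (M *v v))"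
  by (induction vs) (simp_all add: inner_add_right inner_rank_one)

lemma pos_semidef_inner_nonneg:
  assumes "pos_semidef M" and "pos_semidef X"
  shows "0 \<le> M \<bullet> X"
proof -
  obtain vs where "X = (\<Sum>v\<leftarrow>vs. rank_one v)"
    using pos_semidef_eq_sum_rank_one[OF assms(2)] by blast
  then show ?thesis
    using assms(1) by (auto simp: inner_sum_rank_one pos_semidef_def intro!: sum_list_nonneg)
qed

text \<open>Complementary slackness: over the rank-one terms of \<open>X\<close>, the numbers
  \<open>v \<bullet> (M *v v)\<close> are nonnegative with sum zero, so every \<open>v\<close>, and
  with it the range of \<open>X\<close>, lies in the kernel of \<open>M\<close>.\<close>

lemma pos_semidef_inner_le_0_imp_mult_eq_0:
  assumes "pos_semidef M" and "pos_semidef X" and "M \<bullet> X \<le> 0"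
  shows "M ** X = 0"
proof -
  obtain vs where X: "X = (\<Sum>v\<leftarrow>vs. rank_one v)"
    using pos_semidef_eq_sum_rank_one[OF assms(2)] by blast
  have "(\<Sum>v\<leftarrow>vs. v \<bullet> (M *v v)) = 0"
    using assms pos_semidef_inner_nonneg[OF assms(1,2)] by (simp add: X inner_sum_rank_one)
  then have "\<forall>v\<in>set vs. v \<bullet> (M *v v) = 0"
    using assms(1) by (subst (asm) sum_list_nonneg_eq_0_iff) (auto simp: pos_semidef_def)
  then have "\<forall>v\<in>set vs. M *v v = 0"
    using pos_semidef_mult_eq_0[OF assms(1)] by blast
  then have "M *v (X *v x) = 0" for x
    unfolding X
    by (induction vs) (simp_all add: matrix_vector_mult_add_rdistrib matrix_vector_right_distrib
        rank_one_mult_vec matrix_vector_mult_scaleR)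
  then show ?thesis
    by (simp add: matrix_eq matrix_vector_mul_assoc[symmetric])
qed

text \<open>Here \<open>M\<close> has trivial kernel. This yields both the compactness of the
  feasible set and the closedness of the dual cone.\<close>

lemma pos_def_inner_le_0_imp_eq_0:
  assumes "pos_def M" and "pos_semidef X" and "M \<bullet> X \<le> 0"
  shows "X = 0"
proof -
  have "M *v (X *v x) = 0" for x
    using pos_semidef_inner_le_0_imp_mult_eq_0[OF pos_def_imp_pos_semidef[OF assms(1)] assms(2,3)]
    by (simp add: matrix_vector_mul_assoc)
  then have "X *v x = 0" for x
    using assms(1) unfolding pos_def_def by (metis inner_zero_right less_irrefl)
  then show ?thesis
    by (simp add: matrix_eq)
qed

section \<open>The closed convex cone of positive semidefinite matrices\<close>

lemma pos_semidef_0: "pos_semidef 0"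
  by (simp add: pos_semidef_def symmetric_mat_def transpose_def vec_eq_iff)

lemma pos_semidef_add: "pos_semidef M \<Longrightarrow> pos_semidef N \<Longrightarrow> pos_semidef (M + N)"
  by (simp add: pos_semidef_def symmetric_mat_def transpose_def vec_eq_iff
      matrix_vector_mult_add_rdistrib inner_add_right)

lemma pos_semidef_scaleR: "pos_semidef M \<Longrightarrow> 0 \<le> c \<Longrightarrow> pos_semidef (c *\<^sub>R M)"
  by (simp add: pos_semidef_def symmetric_mat_def transpose_def vec_eq_iff
      scaleR_matrix_vector_assoc[symmetric])

lemma closed_pos_semidef: "closed {X :: real^'n^'n. pos_semidef X}"
proof -
  have "{X :: real^'n^'n. pos_semidef X} =
      (\<Inter>i. \<Inter>j. {X. X $ i $ j = X $ j $ i}) \<inter> (\<Inter>x. {X. 0 \<le> X \<bullet> rank_one x})"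
    by (auto simp: pos_semidef_def inner_rank_one symmetric_mat_nth intro: symmetric_matI)
  then show ?thesis
    by (simp only:) (intro closed_INT closed_Int ballI closed_Collect_eq closed_Collect_le continuous_intros)
qed

section \<open>Forests\<close>

text \<open>A walk that returns to a vertex already on the path is cut back to that vertex.\<close>

lemma rtrancl_imp_simple_path:
  assumes "(a, b) \<in> R\<^sup>*"
  shows "\<exists>vs. vs \<noteq> [] \<and> distinct vs \<and> hd vs = a \<and> last vs = b \<and> successively (\<lambda>x y. (x, y) \<in> R) vs"
  using assms
proof (induction rule: rtrancl_induct)
  case base
  show ?case
    by (intro exI[of _ "[a]"]) simp
next
  case (step b c)
  then obtain vs where vs: "vs \<noteq> []" "distinct vs" "hd vs = a" "last vs = b"
      "successively (\<lambda>x y. (x, y) \<in> R) vs"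
    by blast
  show ?case
  proof (cases "c \<in> set vs")
    case True
    then obtain ys zs where "vs = ys @ c # zs"
      by (meson split_list)
    with vs show ?thesis
      by (intro exI[of _ "ys @ [c]"]) (auto simp: successively_append_iff hd_append split: if_splits)
  next
    case False
    with vs step.hyps show ?thesis
      by (intro exI[of _ "vs @ [c]"]) (auto simp: successively_append_iff)
  qed
qed

text \<open>A simple path from \<open>w\<close> to \<open>v\<close> avoiding the edge
  \<open>{v, w}\<close> would be closed to a cycle by that edge.\<close>

lemma forest_edge_is_bridge:
  assumes "is_forest E" and "{v, w} \<in> E" and "v \<noteq> w"
  shows "(w, v) \<notin> {(i, j). {i, j} \<in> E - {{v, w}}}\<^sup>*"
proof
  assume "(w, v) \<in> {(i, j). {i, j} \<in> E - {{v, w}}}\<^sup>*"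
  then obtain vs where vs: "vs \<noteq> []" "distinct vs" "hd vs = w" "last vs = v"
      "successively (\<lambda>i j. {i, j} \<in> E - {{v, w}}) vs"
    using rtrancl_imp_simple_path[of w v] by force
  have nth: "{vs ! i, vs ! Suc i} \<in> E - {{v, w}}" if "Suc i < length vs" for i
    using successively_nth[OF vs(5) that] .
  have ends: "vs ! 0 = w" "vs ! (length vs - 1) = v"
    using vs by (simp_all add: hd_conv_nth last_conv_nth)
  \<comment> \<open>Length 1 would identify \<open>v\<close> and \<open>w\<close>; length 2 would
    use the deleted edge.\<close>
  have "length vs \<noteq> 0" "length vs \<noteq> 1" "length vs \<noteq> 2"
    using vs(1) ends nth[of 0] \<open>v \<noteq> w\<close> by (auto simp: insert_commute)
  then have "3 \<le> length vs"
    by linarith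
  moreover have "{vs ! i, vs ! (Suc i mod length vs)} \<in> E" if "i < length vs" for i
  proof (cases "Suc i < length vs")
    case True
    then show ?thesis
      using nth[of i] by simp
  next
    case False
    then have "i = length vs - 1" "Suc i = length vs"
      using that by linarith+
    then show ?thesis
      using ends assms(2) by simp
  qed
  ultimately have "is_cycle E vs"
    using vs(2) by (simp add: is_cycle_def)
  then show False
    using assms(1) by (auto simp: is_forest_def)
qed

text \<open>
  Cut the edge \<open>{v, w}\<close> and restrict \<open>u\<close> to the side of \<open>w\<close>. As \<open>u\<close> vanishes at \<open>v\<close>,
  the restriction \<open>c\<close> satisfies \<open>c \<bullet> (S *v c) = 0\<close>, so it lies in the kernel too; row \<open>v\<close> of
  \<open>S *v c = 0\<close> consists of the single term \<open>S $ v $ w * u $ w\<close>.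
\<close>

lemma kernel_vanishes_across_edge:
  fixes S :: "real^'n^'n"
  assumes psd: "pos_semidef S" and ker: "S *v u = 0"
    and forest: "is_forest E" and supp: "\<And>i j. i \<noteq> j \<Longrightarrow> S $ i $ j \<noteq> 0 \<Longrightarrow> {i, j} \<in> E"
    and edge: "{v, w} \<in> E" "v \<noteq> w" "S $ v $ w \<noteq> 0" and "u $ v = 0"
  shows "u $ w = 0"
proof -
  define R where "R = {(i, j). {i, j} \<in> E - {{v, w}}}"
  define C where "C = {i. (w, i) \<in> R\<^sup>*}"
  define c where "c = (\<chi> i. if i \<in> C then u $ i else 0)"
  have "w \<in> C" "v \<notin> C"
    using forest_edge_is_bridge[OF forest edge(1,2)] by (auto simp: C_def R_def)
  have C_closed: "j \<in> C" if "i \<in> C" "{i, j} \<in> E" "{i, j} \<noteq> {v, w}" for i j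
  proof -
    have "(i, j) \<in> R"
      using that by (simp add: R_def)
    then show ?thesis
      using that(1) unfolding C_def by (auto intro: rtrancl_into_rtrancl)
  qed
  \<comment> \<open>The only edge leaving \<open>C\<close> is \<open>{v, w}\<close>, and it leads to
    \<open>v\<close>, where \<open>u\<close> vanishes; so truncating \<open>u\<close> to
    \<open>C\<close> does not change the rows in \<open>C\<close>.\<close>
  have row: "(S *v c) $ i = 0" if "i \<in> C" for i
  proof -
    have "S $ i $ j * c $ j = S $ i $ j * u $ j" for j
    proof (cases "j \<in> C \<or> S $ i $ j = 0")
      case False
      then have "{i, j} \<in> E"
        using supp that by metis
      then have "{i, j} = {v, w}"
        using C_closed[OF that] False by blast
      then have "j = v"
        using False \<open>w \<in> C\<close> by (auto simp: doubleton_eq_iff)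
      then show ?thesis
        using \<open>v \<notin> C\<close> \<open>u $ v = 0\<close> by (simp add: c_def)
    qed (auto simp: c_def)
    then have "(S *v c) $ i = (S *v u) $ i"
      by (simp only: matrix_vector_mult_def vec_lambda_beta)
    then show ?thesis
      by (simp add: ker)
  qed
  have "c $ i * (S *v c) $ i = 0" for i
    using row[of i] by (auto simp: c_def)
  then have "c \<bullet> (S *v c) = 0"
    by (simp only: inner_vec_def inner_real_def sum.neutral_const)
  then have "S *v c = 0"
    by (rule pos_semidef_mult_eq_0[OF psd])
  have "S $ v $ j * c $ j = (if j = w then S $ v $ w * u $ w else 0)" for j
  proof (cases "j = w")
    case True
    then show ?thesis
      using \<open>w \<in> C\<close> by (simp add: c_def)
  next
    case False
    show ?thesis
    proof (cases "j \<in> C \<and> S $ v $ j \<noteq> 0")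
      case True
      then have "{v, j} \<in> E"
        using supp \<open>v \<notin> C\<close> by metis
      then have "{j, v} \<in> E"
        by (simp add: insert_commute)
      moreover have "{j, v} \<noteq> {v, w}"
        using False by (auto simp: doubleton_eq_iff)
      ultimately have "v \<in> C"
        using True C_closed by blast
      with \<open>v \<notin> C\<close> show ?thesis
        by contradiction
    qed (use False in \<open>auto simp: c_def\<close>)
  qed
  then have "(S *v c) $ v = S $ v $ w * u $ w"
    by (simp add: matrix_vector_mult_def)
  then show ?thesis
    using \<open>S *v c = 0\<close> edge(3) by simp
qed

text \<open>The zero at \<open>r\<close> spreads edge by edge along a path; each crossing needs a
  nonzero entry of \<open>S\<close>, so the support must be all of \<open>E\<close>.\<close>

lemma kernel_vanishes_on_component:
  fixes S :: "real^'n^'n"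
  assumes "pos_semidef S" and "S *v u = 0" and "is_forest E"
    and supp: "\<And>i j. i \<noteq> j \<Longrightarrow> {i, j} \<in> E \<longleftrightarrow> S $ i $ j \<noteq> 0"
    and path: "(r, i) \<in> {(i, j). {i, j} \<in> E}\<^sup>*" and "u $ r = 0"
  shows "u $ i = 0"
  using path
proof (induction rule: rtrancl_induct)
  case base
  show ?case
    by fact
next
  case (step v w)
  \<comment> \<open>A step may be a loop, since \<open>is_forest\<close> does not exclude singletons
    from \<open>E\<close>.\<close>
  show ?case
  proof (cases "v = w")
    case False
    then show ?thesis
      using step assms kernel_vanishes_across_edge[of S u E v w] by (metis (lifting) case_prodD mem_Collect_eq)
  qed (use step.IH in simp)
qed

text \<open>
  Each column of \<open>X\<close> lies in the kernel of \<open>S\<close>, which on a component is determined by the entry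
  at a root \<open>r\<close>. So \<open>X\<close> agrees on that component with \<open>x x\<^sup>T\<close>, \<open>x\<close> being column \<open>r\<close> of \<open>X\<close>
  divided by \<open>sqrt (X $ r $ r)\<close>; if \<open>X $ r $ r = 0\<close>, both vanish there (division by \<open>0\<close> gives \<open>0\<close>).
\<close>

lemma rank_one_on_components:
  fixes S X :: "real^'n^'n"
  assumes psd: "pos_semidef S" "pos_semidef X" and ker: "S ** X = 0" and "is_forest E"
    and supp: "\<And>i j. i \<noteq> j \<Longrightarrow> {i, j} \<in> E \<longleftrightarrow> S $ i $ j \<noteq> 0"
  obtains x where "\<And>i j. i = j \<or> {i, j} \<in> E \<Longrightarrow> rank_one x $ i $ j = X $ i $ j"
proof -
  define R where "R = {(i :: 'n, j). {i, j} \<in> E}"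
  \<comment> \<open>The choice predicate is the same for all vertices of a component, so adjacent
    vertices get equal roots.\<close>
  define rt where "rt i = (SOME r. (r, i) \<in> R\<^sup>*)" for i
  define x :: "real^'n" where "x = (\<chi> i. X $ i $ rt i / sqrt (X $ rt i $ rt i))"
  have sym: "X $ i $ j = X $ j $ i" for i j
    using psd(2) symmetric_mat_nth by (auto simp: pos_semidef_def)
  have "sym R"
    by (auto simp: R_def sym_def insert_commute)
  have rt: "(rt i, i) \<in> R\<^sup>*" for i
    unfolding rt_def by (rule someI[of _ i]) simp
  have rt_eq: "rt i = rt j" if "(i, j) \<in> R" for i j
  proof -
    have "(j, i) \<in> R"
      using that \<open>sym R\<close> by (auto dest: symD)
    then have "(r, i) \<in> R\<^sup>* \<longleftrightarrow> (r, j) \<in> R\<^sup>*" for r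
      using that by (meson rtrancl.rtrancl_into_rtrancl)
    then show ?thesis
      by (simp add: rt_def)
  qed
  have van: "u $ i = 0" if "S *v u = 0" "u $ rt i = 0" for u i
    using kernel_vanishes_on_component[OF psd(1) that(1) \<open>is_forest E\<close> supp _ that(2)] rt[of i]
    by (simp add: R_def)
  have col: "S *v column j X = 0" for j
  proof -
    have "S *v (X *v axis j 1) = 0"
      by (simp add: matrix_vector_mul_assoc ker)
    then show ?thesis
      by (simp add: matrix_vector_mult_basis)
  qed
  have "x $ i * x $ j = X $ i $ j" if "rt i = rt j" for i j
  proof -
    define r where "r = rt i"
    show ?thesis
    proof (cases "X $ r $ r = 0")
      case True
      then have "column j X $ rt i = 0"
        using pos_semidef_diag_eq_0[OF psd(2)] by (simp add: column_def r_def)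
      then have "X $ i $ j = 0"
        using van[OF col] by (simp add: column_def)
      then show ?thesis
        using True by (simp add: x_def r_def)
    next
      case False
      then have pos: "X $ r $ r > 0"
        using pos_semidef_diag_nonneg[OF psd(2), of r] by simp
      \<comment> \<open>This combination of kernel vectors is built to vanish at the root. Its entry
        at \<open>i\<close> is the minor of \<open>X\<close> with rows \<open>r\<close>,
        \<open>i\<close> and columns \<open>r\<close>, \<open>j\<close>.\<close>
      define u where "u = X $ r $ r *\<^sub>R column j X - X $ r $ j *\<^sub>R column r X"
      have "S *v u = 0"
        by (simp add: u_def matrix_vector_mult_diff_distrib matrix_vector_mult_scaleR col)
      moreover have "u $ rt i = 0"
        by (simp add: u_def column_def r_def)
      ultimately have "u $ i = 0"
        by (rule van)
      then have "X $ r $ r * X $ i $ j = X $ i $ r * X $ j $ r"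
        by (simp add: u_def column_def sym[of r j])
      then show ?thesis
        using pos that by (simp add: x_def r_def[symmetric] field_simps)
    qed
  qed
  moreover have "rt i = rt j" if "i = j \<or> {i, j} \<in> E" for i j
    using that rt_eq by (auto simp: R_def)
  ultimately show thesis
    using that[of x] by (simp add: rank_one_nth)
qed

section \<open>Strong duality\<close>

text \<open>Pointedness keeps the unit vectors of \<open>S\<close> at a positive distance from the
  negated \<open>T\<close>, so the summand from \<open>S\<close> is bounded by a multiple of the
  norm of the sum. A convergent sequence of sums then stays in a compact part of \<open>S\<close>
  plus \<open>T\<close>, which is closed.\<close>

lemma closed_cone_sums:
  fixes S T :: "'a::euclidean_space set"
  assumes "closed S" "convex_cone S" "closed T" "convex_cone T"
    and pointed: "\<And>x. x \<in> S \<Longrightarrow> - x \<in> T \<Longrightarrow> x = 0"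
  shows "closed (\<Union>x\<in>S. \<Union>y\<in>T. {x + y})"
proof -
  have "compact (S \<inter> sphere 0 1)"
    using \<open>closed S\<close> by (simp add: closed_Int_compact)
  moreover have "closed (uminus ` T)"
    using \<open>closed T\<close> by (rule closed_negations)
  moreover have "S \<inter> sphere 0 1 \<inter> uminus ` T = {}"
    using pointed by force
  ultimately obtain d where "d > 0" and d: "\<And>x y. x \<in> S \<inter> sphere 0 1 \<Longrightarrow> y \<in> uminus ` T \<Longrightarrow> d \<le> dist x y"
    using separate_compact_closed by metis
  have norm_le: "norm x \<le> norm (x + y) / d" if "x \<in> S" "y \<in> T" for x y
  proof (cases "x = 0")
    case True
    then show ?thesis
      using \<open>d > 0\<close> by simp
  next
    case False
    define c where "c = inverse (norm x)"
    have "c > 0"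
      using False by (simp add: c_def)
    have "c *\<^sub>R x \<in> S \<inter> sphere 0 1" "- (c *\<^sub>R y) \<in> uminus ` T"
      using that False \<open>c > 0\<close> assms(2,4) by (auto simp: c_def convex_cone_scaleR)
    then have "d \<le> dist (c *\<^sub>R x) (- (c *\<^sub>R y))"
      by (rule d)
    also have "\<dots> = norm (c *\<^sub>R (x + y))"
      by (simp add: dist_norm scaleR_add_right)
    also have "\<dots> = norm (x + y) / norm x"
      using \<open>c > 0\<close> by (simp add: c_def divide_inverse_commute)
    finally show ?thesis
      using \<open>d > 0\<close> False by (simp add: field_simps)
  qed
  show ?thesis
    unfolding closed_sequential_limits
  proof (intro allI impI, elim conjE)
    fix z l
    assume z: "\<forall>n. z n \<in> (\<Union>x\<in>S. \<Union>y\<in>T. {x + y})" and lim: "z \<longlonglongrightarrow> l"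
    obtain r where r: "\<And>n. norm (z n) \<le> r"
      using convergent_imp_bounded[OF lim] by (auto simp: bounded_iff)
    define K where "K = (\<Union>x\<in>S \<inter> cball 0 (r / d). \<Union>y\<in>T. {x + y})"
    have "closed K"
      unfolding K_def using assms(1,3) by (intro compact_closed_sums) (simp_all add: closed_Int_compact)
    moreover have "z n \<in> K" for n
    proof -
      obtain x y where xy: "x \<in> S" "y \<in> T" "z n = x + y"
        using z[rule_format, of n] by auto
      have "norm (x + y) / d \<le> r / d"
        using r[of n] \<open>d > 0\<close> xy(3) by (simp add: divide_right_mono)
      then have "norm x \<le> r / d"
        using norm_le[OF xy(1,2)] by linarith
      then show ?thesis
        using xy by (auto simp: K_def)
    qed
    ultimately have "l \<in> K"
      using lim by (rule closed_sequentially)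
    then show "l \<in> (\<Union>x\<in>S. \<Union>y\<in>T. {x + y})"
      by (auto simp: K_def)
  qed
qed

text \<open>A linear functional bounded below on a cone is nonnegative there, so strict separation
  can be moved to level zero.\<close>

lemma separating_hyperplane_closed_cone:
  fixes K :: "'a::euclidean_space set"
  assumes "closed K" "convex_cone K" "z \<notin> K"
  obtains a where "a \<bullet> z < 0" "\<And>x. x \<in> K \<Longrightarrow> 0 \<le> a \<bullet> x"
proof -
  obtain a b where ab: "a \<bullet> z < b" "\<And>x. x \<in> K \<Longrightarrow> b < a \<bullet> x"
    using separating_hyperplane_closed_point[of K z] assms by (auto simp: convex_cone_def)
  have "b < 0"
    using ab(2)[of 0] convex_cone_contains_0[OF assms(2)] by simp
  have "0 \<le> a \<bullet> x" if "x \<in> K" for x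
  proof (rule ccontr)
    assume neg: "\<not> 0 \<le> a \<bullet> x"
    then have "(b / (a \<bullet> x)) *\<^sub>R x \<in> K"
      using \<open>b < 0\<close> that by (intro convex_cone_scaleR[OF assms(2)]) (simp_all add: divide_nonpos_neg)
    then show False
      using ab(2) neg by fastforce
  qed
  with that show thesis
    using ab(1) \<open>b < 0\<close> by force
qed

text \<open>Provides multipliers indexed by \<open>A\<close> rather than by the image, so that
  coinciding generators cause no trouble.\<close>

lemma convex_cone_hull_finite_image:
  assumes "finite A" "z \<in> convex_cone hull (f ` A)"
  shows "\<exists>y. (\<forall>p\<in>A. 0 \<le> y p) \<and> z = (\<Sum>p\<in>A. y p *\<^sub>R f p)"
proof -
  define K where "K = {\<Sum>p\<in>A. y p *\<^sub>R f p |y. \<forall>p\<in>A. (0::real) \<le> y p}"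
  have "convex_cone K"
    unfolding convex_cone_iff
  proof (intro conjI ballI allI impI)
    show "0 \<in> K"
      unfolding K_def by (intro CollectI exI[of _ "\<lambda>_. 0"]) simp
  next
    fix u v
    assume "u \<in> K" "v \<in> K"
    then obtain y y' where "u = (\<Sum>p\<in>A. y p *\<^sub>R f p)" "\<forall>p\<in>A. 0 \<le> y p"
        "v = (\<Sum>p\<in>A. y' p *\<^sub>R f p)" "\<forall>p\<in>A. 0 \<le> y' p"
      by (auto simp: K_def)
    then show "u + v \<in> K"
      unfolding K_def
      by (intro CollectI exI[of _ "\<lambda>p. y p + y' p"]) (simp add: scaleR_add_left sum.distrib)
  next
    fix u and c :: real
    assume "u \<in> K" "0 \<le> c"
    then obtain y where "u = (\<Sum>p\<in>A. y p *\<^sub>R f p)" "\<forall>p\<in>A. 0 \<le> y p"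
      by (auto simp: K_def)
    then show "c *\<^sub>R u \<in> K"
      unfolding K_def using \<open>0 \<le> c\<close>
      by (intro CollectI exI[of _ "\<lambda>p. c * y p"]) (simp add: scaleR_sum_right)
  qed
  moreover have "f ` A \<subseteq> K"
  proof
    fix u
    assume "u \<in> f ` A"
    then obtain q where "q \<in> A" "u = f q"
      by blast
    moreover have "(\<Sum>p\<in>A. (if p = q then 1 else 0) *\<^sub>R f p) = f q"
      using \<open>finite A\<close> \<open>q \<in> A\<close> by (simp add: if_distrib[of "\<lambda>c. c *\<^sub>R _"] cong: if_cong)
    ultimately show "u \<in> K"
      unfolding K_def by (intro CollectI exI[of _ "\<lambda>p. if p = q then 1 else 0"]) simp
  qed
  ultimately have "convex_cone hull (f ` A) \<subseteq> K"
    by (simp add: hull_minimal)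
  then show ?thesis
    using assms(2) by (auto simp: K_def)
qed

section \<open>Primal attainment and dual multipliers\<close>

text \<open>Pairing with \<open>M\<close> grows at least linearly in the norm on the semidefinite
  cone, while the constraints weighted by \<open>y\<close> bound it above; so the feasible set is
  compact.\<close>

lemma sdp_optimal_exists:
  fixes Q :: "nat \<Rightarrow> real^'n^'n"
  assumes dual_pd: "\<forall>p\<in>{1..m}. 0 \<le> y p" "pos_def (\<Sum>p=1..m. y p *\<^sub>R Q p)"
    and "sdp_feasible m Q b X0"
  shows "\<exists>X. sdp_optimal m Q b X"
proof -
  define M where "M = (\<Sum>p=1..m. y p *\<^sub>R Q p)"
  define F where "F = {X. sdp_feasible m Q b X}"
  obtain d where "d > 0" and d: "\<And>X. pos_semidef X \<Longrightarrow> norm X = 1 \<Longrightarrow> d \<le> M \<bullet> X"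
  proof (cases "{X :: real^'n^'n. pos_semidef X} \<inter> sphere 0 1 = {}")
    case True
    then show ?thesis
      by (intro that[of 1]) auto
  next
    case False
    have "compact ({X :: real^'n^'n. pos_semidef X} \<inter> sphere 0 1)"
      by (simp add: closed_Int_compact closed_pos_semidef)
    moreover have "continuous_on ({X. pos_semidef X} \<inter> sphere 0 1) (\<lambda>X. M \<bullet> X)"
      by (intro continuous_intros)
    ultimately obtain X where "X \<in> {X. pos_semidef X} \<inter> sphere 0 1"
        and min: "\<forall>Y \<in> {X. pos_semidef X} \<inter> sphere 0 1. M \<bullet> X \<le> M \<bullet> Y"
      using continuous_attains_inf False by blast
    then have X: "pos_semidef X" "norm X = 1"
      by auto
    have "M \<bullet> X > 0"
      using pos_def_inner_le_0_imp_eq_0[of M X] X dual_pd(2) by (fastforce simp: M_def)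
    then show ?thesis
      using min by (intro that[of "M \<bullet> X"]) auto
  qed
  have "norm X \<le> (\<Sum>p=1..m. y p * b p) / d" if "X \<in> F" for X
  proof -
    have psd: "pos_semidef X" and lin: "\<And>p. p \<in> {1..m} \<Longrightarrow> Q p \<bullet> X \<le> b p"
      using that by (auto simp: F_def sdp_feasible_def sdp_linear_constraints_def frob_eq_inner)
    have "d * norm X \<le> M \<bullet> X"
    proof (cases "X = 0")
      case False
      then have "d \<le> M \<bullet> (inverse (norm X) *\<^sub>R X)"
        by (intro d pos_semidef_scaleR psd) auto
      then show ?thesis
        using False by (simp add: field_simps)
    qed simp
    also have "\<dots> = (\<Sum>p=1..m. y p * (Q p \<bullet> X))"
      by (simp add: M_def inner_sum_left)
    also have "\<dots> \<le> (\<Sum>p=1..m. y p * b p)"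
      using lin dual_pd(1) by (intro sum_mono mult_left_mono) auto
    finally show ?thesis
      using \<open>d > 0\<close> by (simp add: field_simps)
  qed
  then have "bounded F"
    by (auto simp: bounded_iff)
  moreover have "F = {X. pos_semidef X} \<inter> (\<Inter>p\<in>{1..m}. {X. Q p \<bullet> X \<le> b p})"
    by (auto simp: F_def sdp_feasible_def sdp_linear_constraints_def frob_eq_inner)
  then have "closed F"
    by (simp only:) (intro closed_Int closed_pos_semidef closed_INT ballI closed_Collect_le continuous_intros)
  ultimately have "compact F"
    by (simp add: compact_eq_bounded_closed)
  moreover have "F \<noteq> {}"
    using assms(3) by (auto simp: F_def)
  moreover have "continuous_on F (\<lambda>X. Q 0 \<bullet> X)"
    by (intro continuous_intros)
  ultimately obtain X where "X \<in> F" "\<forall>Y\<in>F. Q 0 \<bullet> X \<le> Q 0 \<bullet> Y"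
    using continuous_attains_inf by blast
  then show ?thesis
    by (auto simp: F_def sdp_optimal_def is_arg_min_linorder frob_eq_inner)
qed

text \<open>
  The multipliers come from writing \<open>(Q 0, - v)\<close> as an element of the cone generated by
  \<open>(Z, 0)\<close> with \<open>Z\<close> positive semidefinite, \<open>(- Q p, b p)\<close> and \<open>(0, 1)\<close>. The interior
  feasible point makes this cone closed, without requiring the linear constraints to hold strictly.
\<close>

lemma sdp_strong_duality:
  fixes Q :: "nat \<Rightarrow> real^'n^'n"
  assumes sym: "\<And>p. p \<in> {0..m} \<Longrightarrow> symmetric_mat (Q p)"
    and dual_pd: "\<forall>p\<in>{1..m}. 0 \<le> y' p" "pos_def (\<Sum>p=1..m. y' p *\<^sub>R Q p)"
    and slater: "sdp_interior_feasible m Q b X0"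
    and bound: "\<And>X. sdp_feasible m Q b X \<Longrightarrow> v \<le> frob (Q 0) X"
  obtains y where "\<forall>p\<in>{1..m}. 0 \<le> y p" "pos_semidef (dual_slack m Q y)"
    "v + (\<Sum>p=1..m. y p * b p) \<le> 0"
proof -
  define S where "S = {Z :: real^'n^'n. pos_semidef Z} \<times> {0 :: real}"
  define g where "g p = (if p = 0 then (0, 1) else (- Q p, b p))" for p
  define T where "T = convex_cone hull (g ` {0..m})"
  define D where "D = (\<Union>z\<in>S. \<Union>t\<in>T. {z + t})"
  have S: "closed S" "convex_cone S"
    unfolding S_def convex_cone_Times
    by (auto simp: convex_cone_iff closed_pos_semidef pos_semidef_0 pos_semidef_add
        pos_semidef_scaleR closed_Times zero_prod_def)
  have T: "closed T" "convex_cone T"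
    unfolding T_def by (simp_all only: closed_convex_cone_hull convex_cone_convex_cone_hull
        finite_imageI finite_atLeastAtMost)
  have T_elim: "\<exists>y. (\<forall>p\<in>{1..m}. 0 \<le> y p) \<and> A = - (\<Sum>p=1..m. y p *\<^sub>R Q p) \<and> (\<Sum>p=1..m. y p * b p) \<le> s"
    if mem: "(A, s) \<in> T" for A s
  proof -
    obtain y where y: "\<forall>p\<in>{0..m}. 0 \<le> y p" "(A, s) = (\<Sum>p\<in>{0..m}. y p *\<^sub>R g p)"
      using convex_cone_hull_finite_image[OF finite_atLeastAtMost mem[unfolded T_def]] by blast
    have "(A, s) = y 0 *\<^sub>R g 0 + (\<Sum>p=1..m. y p *\<^sub>R g p)"
      unfolding y(2) by (simp add: sum.atLeast_Suc_atMost[of 0 m])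
    also have "(\<Sum>p=1..m. y p *\<^sub>R g p) = (\<Sum>p=1..m. (- (y p *\<^sub>R Q p), y p * b p))"
      by (intro sum.cong) (auto simp: g_def)
    also have "\<dots> = (- (\<Sum>p=1..m. y p *\<^sub>R Q p), \<Sum>p=1..m. y p * b p)"
      by (simp add: sum_prod sum_negf)
    finally show ?thesis
      using y(1) by (intro exI[of _ y]) (auto simp: g_def)
  qed
  have X0: "pos_def X0" "\<And>p. p \<in> {1..m} \<Longrightarrow> Q p \<bullet> X0 \<le> b p"
    using slater
    by (auto simp: sdp_interior_feasible_def sdp_linear_constraints_def frob_eq_inner)
  have "closed D"
    unfolding D_def
  proof (rule closed_cone_sums[OF S T])
    fix z
    assume "z \<in> S" "- z \<in> T"
    then obtain Z where Z: "z = (Z, 0)" "pos_semidef Z" "(- Z, 0) \<in> T"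
      by (auto simp: S_def)
    then obtain y where y: "\<forall>p\<in>{1..m}. 0 \<le> y p" "Z = (\<Sum>p=1..m. y p *\<^sub>R Q p)"
        "(\<Sum>p=1..m. y p * b p) \<le> 0"
      using T_elim[OF Z(3)] by auto
    \<comment> \<open>Pairing with the positive definite \<open>X0\<close> shows that the
      semidefinite cone meets the negated \<open>T\<close> only in the origin.\<close>
    have "X0 \<bullet> Z = (\<Sum>p=1..m. y p * (Q p \<bullet> X0))"
      by (simp add: y(2) inner_sum_right inner_commute)
    also have "\<dots> \<le> (\<Sum>p=1..m. y p * b p)"
      using X0(2) y(1) by (intro sum_mono mult_left_mono) auto
    also have "\<dots> \<le> 0"
      by (rule y(3))
    finally have "Z = 0"
      by (rule pos_def_inner_le_0_imp_eq_0[OF X0(1) Z(2)])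
    then show "z = 0"
      by (simp add: Z(1) zero_prod_def)
  qed
  have "convex_cone D"
    unfolding D_def using S(2) T(2) by (rule convex_cone_sums)
  have "(Q 0, - v) \<in> D"
  proof (rule ccontr)
    assume "(Q 0, - v) \<notin> D"
    then obtain a where a: "a \<bullet> (Q 0, - v) < 0" "\<And>x. x \<in> D \<Longrightarrow> 0 \<le> a \<bullet> x"
      using separating_hyperplane_closed_cone[OF \<open>closed D\<close> \<open>convex_cone D\<close>] by blast
    obtain A s where "a = (A, s)"
      by fastforce
    have "S \<subseteq> D" "T \<subseteq> D"
      using convex_cone_contains_0[OF S(2)] convex_cone_contains_0[OF T(2)]
      by (force simp: D_def)+
    have "g p \<in> D" if "p \<le> m" for p
      using \<open>T \<subseteq> D\<close> hull_inc[of "g p" "g ` {0..m}" convex_cone] that by (auto simp: T_def)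
    then have ag: "0 \<le> a \<bullet> g p" if "p \<le> m" for p
      using a(2) that by blast
    have "s \<ge> 0"
      using ag[of 0] by (simp add: g_def \<open>a = (A, s)\<close>)
    have AQ: "A \<bullet> Q p \<le> s * b p" if "p \<in> {1..m}" for p
      using ag[of p] that by (simp add: g_def \<open>a = (A, s)\<close>)
    have AZ: "0 \<le> A \<bullet> Z" if "pos_semidef Z" for Z
    proof -
      have "(Z, 0) \<in> D"
        using \<open>S \<subseteq> D\<close> that by (auto simp: S_def)
      then show ?thesis
        using a(2) by (force simp: \<open>a = (A, s)\<close>)
    qed
    \<comment> \<open>The separating functional \<open>A\<close> need not be symmetric, but the
      symmetric data see only its symmetric part.\<close>
    define X where "X = (1/2) *\<^sub>R (A + transpose A)"
    have QX: "N \<bullet> X = A \<bullet> N" if "symmetric_mat N" for N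
      using symmetric_mat_transpose_inner[OF that, of A]
      by (simp add: X_def inner_add_right inner_commute)
    have "pos_semidef X"
      unfolding pos_semidef_def
    proof (intro conjI allI)
      show "symmetric_mat X"
        by (intro symmetric_matI) (simp add: X_def transpose_def)
    next
      fix x
      have "0 \<le> A \<bullet> rank_one x"
        by (intro AZ pos_semidef_rank_one)
      also have "\<dots> = X \<bullet> rank_one x"
        using QX[of "rank_one x"] pos_semidef_rank_one[of x]
        by (simp add: pos_semidef_def inner_commute)
      finally show "0 \<le> x \<bullet> (X *v x)"
        by (simp add: inner_rank_one)
    qed
    have QX_le: "Q p \<bullet> X \<le> s * b p" if "p \<in> {1..m}" for p
      using AQ[OF that] QX[OF sym] that by simp
    have Q0X: "Q 0 \<bullet> X < s * v"
      using a(1) QX[OF sym, of 0] by (simp add: \<open>a = (A, s)\<close>)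
    \<comment> \<open>For \<open>s = 0\<close>, \<open>X\<close> would be a recession direction with
      negative objective, which \<open>dual_pd\<close> excludes; for \<open>s > 0\<close>, scaling
      \<open>X\<close> by \<open>inverse s\<close> gives a feasible point with value below
      \<open>v\<close>.\<close>
    show False
    proof (cases "s = 0")
      case True
      have "(\<Sum>p=1..m. y' p *\<^sub>R Q p) \<bullet> X = (\<Sum>p=1..m. y' p * (Q p \<bullet> X))"
        by (simp add: inner_sum_left)
      also have "\<dots> \<le> 0"
        using QX_le dual_pd(1) True by (intro sum_nonpos mult_nonneg_nonpos) auto
      finally have "X = 0"
        using pos_def_inner_le_0_imp_eq_0[OF dual_pd(2) \<open>pos_semidef X\<close>] by simp
      then show False
        using Q0X True by simp
    next
      case False
      then have "s > 0"
        using \<open>s \<ge> 0\<close> by simp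
      then have "sdp_feasible m Q b (inverse s *\<^sub>R X)"
        using QX_le \<open>pos_semidef X\<close>
        by (simp add: sdp_feasible_def sdp_linear_constraints_def frob_eq_inner
            pos_semidef_scaleR field_simps)
      then have "v \<le> inverse s * (Q 0 \<bullet> X)"
        using bound by (force simp: frob_eq_inner)
      then show False
        using Q0X \<open>s > 0\<close> by (simp add: field_simps)
    qed
  qed
  then obtain Z t where Z: "pos_semidef Z" "t \<in> T" "(Q 0, - v) = (Z, 0) + t"
    by (auto simp: D_def S_def)
  then have "(Q 0 - Z, - v) \<in> T"
    by (cases t) auto
  then obtain y where y: "\<forall>p\<in>{1..m}. 0 \<le> y p" "Q 0 - Z = - (\<Sum>p=1..m. y p *\<^sub>R Q p)"
      "(\<Sum>p=1..m. y p * b p) \<le> - v"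
    using T_elim by blast
  have "dual_slack m Q y = Z"
    using y(2) by (simp add: dual_slack_def algebra_simps)
  then show thesis
    using that y Z(1) by simp
qed

theorem theorem3p4:
  fixes Q :: "nat \<Rightarrow> real ^ 'n::{finite,linorder} ^ 'n::{finite,linorder}"
    and b :: "nat \<Rightarrow> real"
    and m :: nat
  assumes sym: "\<And>p. p \<in> {0..m} \<Longrightarrow> symmetric_mat (Q p)"
    and feas: "\<exists>x. qcqp_feasible m Q b x"
    and dual_pd: "\<exists>y :: nat \<Rightarrow> real. (\<forall>p\<in>{1..m}. 0 \<le> y p) \<and> pos_def (\<Sum>p=1..m. y p *\<^sub>R Q p)"
    and slater: "\<exists>X. sdp_interior_feasible m Q b X"
    and forest: "forest_structured m Q"
    and no_sol: "\<And>k l. (k, l) \<in> od m Q \<Longrightarrow>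
      \<nexists>y :: nat \<Rightarrow> real. (\<forall>p\<in>{1..m}. 0 \<le> y p) \<and>
        pos_semidef (dual_slack m Q y) \<and> dual_slack m Q y $ k $ l = 0"
  shows "sdp_exact m Q b"
proof -
  obtain y' where y': "\<forall>p\<in>{1..m}. 0 \<le> y' p" "pos_def (\<Sum>p=1..m. y' p *\<^sub>R Q p)"
    using dual_pd by blast
  obtain x0 where "sdp_feasible m Q b (rank_one x0)"
    using feas sdp_feasible_rank_one by blast
  then obtain X where X: "sdp_optimal m Q b X"
    using sdp_optimal_exists[OF y'] by blast
  then have X_feas: "pos_semidef X" "\<And>p. p \<in> {1..m} \<Longrightarrow> Q p \<bullet> X \<le> b p"
    and X_min: "\<And>Y. sdp_feasible m Q b Y \<Longrightarrow> frob (Q 0) X \<le> frob (Q 0) Y"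
    by (auto simp: sdp_optimal_def is_arg_min_linorder sdp_feasible_def
        sdp_linear_constraints_def frob_eq_inner)
  obtain X0 where "sdp_interior_feasible m Q b X0"
    using slater by blast
  \<comment> \<open>With \<open>v\<close> the attained primal value, these multipliers leave no
    duality gap.\<close>
  then obtain y where y: "\<forall>p\<in>{1..m}. 0 \<le> y p" "pos_semidef (dual_slack m Q y)"
      "Q 0 \<bullet> X + (\<Sum>p=1..m. y p * b p) \<le> 0"
    using sdp_strong_duality[OF sym y' _ X_min] by (auto simp: frob_eq_inner)
  define S where "S = dual_slack m Q y"
  define E where "E = {{i, j} |i j. (i, j) \<in> od m Q}"
  have "S \<bullet> X = Q 0 \<bullet> X + (\<Sum>p=1..m. y p * (Q p \<bullet> X))"
    by (simp add: S_def dual_slack_def inner_add_left inner_sum_left)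
  also have "\<dots> \<le> Q 0 \<bullet> X + (\<Sum>p=1..m. y p * b p)"
    using X_feas(2) y(1) by (intro add_left_mono sum_mono mult_left_mono) auto
  finally have "S ** X = 0"
    using pos_semidef_inner_le_0_imp_mult_eq_0[OF y(2) X_feas(1)] y(3) by (simp add: S_def)
  have entry: "Q p $ i $ j = 0" if "i \<noteq> j" "{i, j} \<notin> E" "p \<in> {0..m}" for p i j
  proof -
    have "(i, j) \<notin> od m Q" "(j, i) \<notin> od m Q"
      using that(2) by (auto simp: E_def insert_commute)
    then have "Q p $ i $ j = 0 \<or> Q p $ j $ i = 0"
      using that(1,3) unfolding od_def sparsity_edges_def by (cases i j rule: linorder_cases) blast+
    then show ?thesis
      using symmetric_mat_nth[OF sym[OF that(3)], of i j] by auto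
  qed
  \<comment> \<open>A zero of \<open>S\<close> on an edge would make \<open>y\<close> a solution of
    an excluded system; off the diagonal and the edges all data matrices vanish.\<close>
  have supp: "{i, j} \<in> E \<longleftrightarrow> S $ i $ j \<noteq> 0" if "i \<noteq> j" for i j
  proof
    assume "{i, j} \<in> E"
    then have "(i, j) \<in> od m Q \<or> (j, i) \<in> od m Q"
      by (auto simp: E_def doubleton_eq_iff)
    then have "S $ i $ j \<noteq> 0 \<or> S $ j $ i \<noteq> 0"
      using no_sol y(1,2) unfolding S_def by blast
    then show "S $ i $ j \<noteq> 0"
      using y(2) symmetric_mat_nth[of S i j] by (auto simp: S_def pos_semidef_def)
  next
    assume "S $ i $ j \<noteq> 0"
    then show "{i, j} \<in> E"
      using entry[OF that] by (fastforce simp: S_def dual_slack_def)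
  qed
  have "is_forest E"
    using forest by (simp add: forest_structured_def E_def)
  then obtain x where x: "\<And>i j. i = j \<or> {i, j} \<in> E \<Longrightarrow> rank_one x $ i $ j = X $ i $ j"
    using rank_one_on_components[of S X E] y(2) X_feas(1) \<open>S ** X = 0\<close> supp
    unfolding S_def by blast
  \<comment> \<open>The data are supported on the diagonal and on \<open>E\<close>, where
    \<open>rank_one x\<close> and \<open>X\<close> agree, so feasibility and objective value carry
    over.\<close>
  have "Q p \<bullet> rank_one x = Q p \<bullet> X" if "p \<in> {0..m}" for p
  proof -
    have "Q p $ i $ j * rank_one x $ i $ j = Q p $ i $ j * X $ i $ j" for i j
      using x[of i j] entry[of i j p] that by auto
    then show ?thesis
      by (simp only: inner_vec_def inner_real_def)
  qed
  then have "sdp_optimal m Q b (rank_one x)"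
    using X by (simp add: sdp_optimal_def is_arg_min_linorder sdp_feasible_def
        sdp_linear_constraints_def frob_eq_inner pos_semidef_rank_one)
  then show ?thesis
    by (auto simp: sdp_exact_def)
qed

end
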